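(* Let $z_{k-1}\ne z_k$ in $\mathbb{R}^{n+1}$, $s_{k-1}=z_k-z_{k-1}$, let $b_k\in\mathbb{R}^{n+1}$ be nonzero, $\vartheta>1$, $g_k=\nabla\Phi_\tau(z_k)$, and let $\mu_k^\star$ and $d_k$ be as defined in the context. Then for every $0\le\mu_k\le\mu_k^\star$, $$-g_k^Td_k\ge\zeta_\vartheta\,d_k^TP_kd_k,\qquad \zeta_\vartheta=1-\vartheta^{-2}.$$ The constant is identical to the baseline $\mu_k=0$ worst-case constant and is independent of $b_k$, $k$, and $\tau$.
   Context: Let $n,m\ge1$ and let $f_1,\dots,f_m\in C^1(\mathbb{R}^n)$ have gradients that are Lipschitz on $\mathbb{R}^n$ with constants $L_i\ge0$; $\bar L=\sum_i L_i$; $\tau>0$, $\delta>0$. Let $\phi_\tau(r)=\frac{r+\sqrt{r^2+\tau^2}}{2}$ and $\Phi_\tau(x,t)=t+\sum_{i=1}^m\phi_\tau(f_i(x)-t)$ on $\mathbb{R}^{n+1}$. At $z_k=(x_k,t_k)$ let $\omega_{i,k}=\sqrt{(f_i(x_k)-t_k)^2+\tau^2}$, $J_k$ the $m\times(n+1)$ matrix with rows $(\nabla f_i(x_k)^T,-1)$, $D_k=\operatorname{diag}(\omega_{1,k}^{-1},\dots,\omega_{m,k}^{-1})$, $\Pi_x=\operatorname{diag}(I_n,0)$, and $P_k=\delta I_{n+1}+\bar L\Pi_x+\frac12J_k^TD_kJ_k$, a symmetric positive definite matrix. Put $C_k=s_{k-1}^TP_ks_{k-1}$, $B_k=b_k^TP_k^{-1}b_k$,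 $\Delta_k=s_{k-1}^Tb_k$, $\chi_k=\Delta_k/\sqrt{C_kB_k}\in[-1,1]$, $\mathcal{D}_k=\Delta_k+\vartheta\sqrt{C_kB_k}$ (positive), $\varpi_k^2=\frac{1-\chi_k^2}{(\vartheta+\chi_k)^2}$, $\Gamma_0=\zeta_\vartheta^{-1}=\frac{\vartheta^2}{\vartheta^2-1}$, $\mu_k^\star=\frac{\Gamma_0-1-\varpi_k^2}{\sqrt{\Gamma_0}+1}$. For $\mu_k\ge0$ the enhanced direction is $$d_k=-P_k^{-1}g_k+\left[\frac{g_k^TP_k^{-1}b_k}{\mathcal{D}_k}-\mu_k\frac{g_k^Ts_{k-1}}{C_k}\right]s_{k-1}-\frac{g_k^Ts_{k-1}}{\mathcal{D}_k}P_k^{-1}b_k.$$ "Baseline" refers to the direction with $\mu_k=0$. "Worst case" refers to the maximum of $\varpi^2=\frac{1-\chi^2}{(\vartheta+\chi)^2}$ over $\chi\in[-1,1]$, which equals $\frac{1}{\vartheta^2-1}=\Gamma_0-1$ and is attained at $\chi=-1/\vartheta$. For $\mu_k=0$ one has $d_k^TP_kd_k\le(1+\varpi_k^2)\,g_k^TP_k^{-1}g_k\le\Gamma_0\,g_k^TP_k^{-1}g_k$ and $-g_k^Td_k=g_k^TP_k^{-1}g_k$, which gives the baseline worst-case constant $\Gamma_0^{-1}=1-\vartheta^{-2}$. *)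

theory Defs
  imports "HOL-Analysis.Analysis"
begin

text \<open>
  The space of pairs \<open>(x, t)\<close> is \<open>real ^ ('n + 1)\<close>: the indices \<open>Inl j\<close> carry \<open>x\<close>, and the
  index \<open>Inr 1\<close> carries \<open>t\<close>.
\<close>

definition x_part :: "real ^ ('n::finite + 1) \<Rightarrow> real ^ 'n" where
  "x_part z = (\<chi> j. z $ Inl j)"

definition t_part :: "real ^ ('n::finite + 1) \<Rightarrow> real" where
  "t_part z = z $ Inr 1"

text \<open>Meaningful only at points where \<open>F\<close> is differentiable.\<close>

definition gradient :: "('a::real_inner \<Rightarrow> real) \<Rightarrow> 'a \<Rightarrow> 'a" where
  "gradient F x = (THE D. GDERIV F x :> D)"

definition C1 :: "('a::real_inner \<Rightarrow> real) \<Rightarrow> bool" where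
  "C1 F \<longleftrightarrow> F differentiable_on UNIV \<and> continuous_on UNIV (gradient F)"

definition diag :: "real ^ 'k::finite \<Rightarrow> real ^ 'k ^ 'k" where
  "diag v = (\<chi> i j. if i = j then v $ i else 0)"


subsection \<open>The smoothed max function and the preconditioner\<close>

definition smooth_plus :: "real \<Rightarrow> real \<Rightarrow> real" where
  "smooth_plus \<tau> r = (r + sqrt (r\<^sup>2 + \<tau>\<^sup>2)) / 2"

definition Phi :: "('m::finite \<Rightarrow> real ^ 'n::finite \<Rightarrow> real) \<Rightarrow> real \<Rightarrow> real ^ ('n + 1) \<Rightarrow> real" where
  "Phi f \<tau> z = t_part z + (\<Sum>i\<in>UNIV. smooth_plus \<tau> (f i (x_part z) - t_part z))"

definition omega :: "('m::finite \<Rightarrow> real ^ 'n::finite \<Rightarrow> real) \<Rightarrow> real \<Rightarrow> real ^ ('n + 1) \<Rightarrow> 'm \<Rightarrow> real" where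
  "omega f \<tau> z i = sqrt ((f i (x_part z) - t_part z)\<^sup>2 + \<tau>\<^sup>2)"

definition J_mat :: "('m::finite \<Rightarrow> real ^ 'n::finite \<Rightarrow> real) \<Rightarrow> real ^ ('n + 1) \<Rightarrow> real ^ ('n + 1) ^ 'm" where
  "J_mat f z = (\<chi> i c. case c of Inl j \<Rightarrow> gradient (f i) (x_part z) $ j | Inr _ \<Rightarrow> - 1)"

definition D_mat :: "('m::finite \<Rightarrow> real ^ 'n::finite \<Rightarrow> real) \<Rightarrow> real \<Rightarrow> real ^ ('n + 1) \<Rightarrow> real ^ 'm ^ 'm" where
  "D_mat f \<tau> z = diag (\<chi> i. inverse (omega f \<tau> z i))"

definition Pi_x :: "real ^ ('n::finite + 1) ^ ('n + 1)" where
  "Pi_x = diag (\<chi> c. case c of Inl _ \<Rightarrow> 1 | Inr _ \<Rightarrow> 0)"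

definition P_mat ::
  "('m::finite \<Rightarrow> real ^ 'n::finite \<Rightarrow> real) \<Rightarrow> ('m \<Rightarrow> real) \<Rightarrow> real \<Rightarrow> real \<Rightarrow> real ^ ('n + 1)
    \<Rightarrow> real ^ ('n + 1) ^ ('n + 1)" where
  "P_mat f L \<delta> \<tau> z =
     \<delta> *\<^sub>R mat 1 + (\<Sum>i\<in>UNIV. L i) *\<^sub>R Pi_x
     + (1/2) *\<^sub>R (transpose (J_mat f z) ** D_mat f \<tau> z ** J_mat f z)"


subsection \<open>The enhanced direction\<close>

definition C_val :: "real ^ 'k::finite ^ 'k \<Rightarrow> real ^ 'k \<Rightarrow> real" where
  "C_val P s = s \<bullet> (P *v s)"

definition B_val :: "real ^ 'k::finite ^ 'k \<Rightarrow> real ^ 'k \<Rightarrow> real" where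
  "B_val P b = b \<bullet> (matrix_inv P *v b)"

definition chi_val :: "real ^ 'k::finite ^ 'k \<Rightarrow> real ^ 'k \<Rightarrow> real ^ 'k \<Rightarrow> real" where
  "chi_val P s b = (s \<bullet> b) / sqrt (C_val P s * B_val P b)"

definition D_val :: "real \<Rightarrow> real ^ 'k::finite ^ 'k \<Rightarrow> real ^ 'k \<Rightarrow> real ^ 'k \<Rightarrow> real" where
  "D_val \<theta> P s b = s \<bullet> b + \<theta> * sqrt (C_val P s * B_val P b)"

definition varpi_sq :: "real \<Rightarrow> real \<Rightarrow> real" where
  "varpi_sq \<theta> c = (1 - c\<^sup>2) / (\<theta> + c)\<^sup>2"

definition zeta :: "real \<Rightarrow> real" where
  "zeta \<theta> = 1 - inverse (\<theta>\<^sup>2)"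

definition Gamma0 :: "real \<Rightarrow> real" where
  "Gamma0 \<theta> = \<theta>\<^sup>2 / (\<theta>\<^sup>2 - 1)"

definition mu_star :: "real \<Rightarrow> real ^ 'k::finite ^ 'k \<Rightarrow> real ^ 'k \<Rightarrow> real ^ 'k \<Rightarrow> real" where
  "mu_star \<theta> P s b = (Gamma0 \<theta> - 1 - varpi_sq \<theta> (chi_val P s b)) / (sqrt (Gamma0 \<theta>) + 1)"

definition direction ::
  "real \<Rightarrow> real ^ 'k::finite ^ 'k \<Rightarrow> real ^ 'k \<Rightarrow> real ^ 'k \<Rightarrow> real ^ 'k \<Rightarrow> real \<Rightarrow> real ^ 'k" where
  "direction \<theta> P g s b \<mu> =
     - (matrix_inv P *v g)
     + ((g \<bullet> (matrix_inv P *v b)) / D_val \<theta> P s b - \<mu> * ((g \<bullet> s) / C_val P s)) *\<^sub>R s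
     - ((g \<bullet> s) / D_val \<theta> P s b) *\<^sub>R (matrix_inv P *v b)"

text \<open>
  For \<open>\<mu> = 0\<close> the direction \<open>d\<close> satisfies \<open>d\<^sup>T P d \<le> (1 + \<varpi>\<^sup>2) (- g\<^sup>T d)\<close>, where \<open>\<varpi>\<^sup>2\<close> depends only on
  \<open>\<theta>\<close> and on the cosine \<open>c\<close> between \<open>s\<close> and \<open>P\<^sup>-\<^sup>1 b\<close> in the \<open>P\<close>-inner product. The baseline
  worst-case constant is the reciprocal of this factor at the maximum of \<open>\<varpi>\<^sup>2\<close> over all cosines.
\<close>

definition baseline_const :: "real \<Rightarrow> real" where
  "baseline_const \<theta> = inverse (1 + (GREATEST w. w \<in> varpi_sq \<theta> ` {-1..1}))"

end

theory Submission imports Defs begin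

text \<open>
  Write \<open>u = P\<^sup>-\<^sup>1 g\<close> and \<open>v = P\<^sup>-\<^sup>1 b\<close> and measure everything in the inner product
  \<open>\<langle>x, y\<rangle> = x\<^sup>T P y\<close>, which is positive definite because \<open>P\<close> is \<open>\<delta> I\<close> plus positive semidefinite
  terms. Then \<open>C = \<langle>s, s\<rangle>\<close>, \<open>B = \<langle>v, v\<rangle>\<close>, \<open>\<Delta> = \<langle>s, v\<rangle>\<close>, \<open>g\<^sup>T x = \<langle>u, x\<rangle>\<close> and
  \<open>d = - u + K u - \<mu> \<Pi> u\<close>. Here \<open>K u = (\<langle>u, v\<rangle> s - \<langle>u, s\<rangle> v) / D\<close> is skew, and \<open>\<Pi>\<close> is the orthogonal
  projection onto the line of \<open>s\<close>. Skewness removes \<open>K\<close> from \<open>- g\<^sup>T d\<close>, which is therefore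
  \<open>\<langle>u, u\<rangle> + \<mu> x\<^sup>2\<close> with \<open>x\<close> the coordinate of \<open>u\<close> along the unit vector of \<open>s\<close>.

  If \<open>y\<close> is the coordinate of \<open>u\<close> along the unit vector obtained from \<open>v\<close> by Gram-Schmidt, then \<open>K\<close> acts
  on the plane of \<open>s\<close> and \<open>v\<close> as a quarter turn scaled by \<open>k = sqrt (C B - \<Delta>\<^sup>2) / D\<close>, and \<open>k\<^sup>2\<close> is exactly
  \<open>\<varpi>\<^sup>2\<close>. Hence
  \<open>d\<^sup>T P d = \<langle>u, u\<rangle> + k\<^sup>2 (x\<^sup>2 + y\<^sup>2) + (2 \<mu> + \<mu>\<^sup>2) x\<^sup>2 - 2 \<mu> k x y\<close>
  (lemma \<open>direction_in_coordinates\<close>), with \<open>x\<^sup>2 + y\<^sup>2 \<le> \<langle>u, u\<rangle>\<close> by Bessel's inequality.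
  At \<open>\<mu> = 0\<close> this gives the baseline statements at once.

  For \<open>\<mu> > 0\<close> the claim becomes nonnegativity of a quadratic form in \<open>x, y\<close>. With the gap
  \<open>e = \<Gamma>\<^sub>0 - 1 - \<varpi>\<^sup>2\<close>, its determinant factors as \<open>(e - \<mu>) (e + (\<Gamma>\<^sub>0 - 1) \<mu>)\<close>, so \<open>\<mu> \<le> e\<close>
  suffices (lemma \<open>damped_rotation_bound\<close>); \<open>\<mu>\<^sup>\<star> = e / (sqrt \<Gamma>\<^sub>0 + 1)\<close> is at most \<open>e\<close> because \<open>e \<ge> 0\<close>.
  The gap is nonnegative because \<open>\<varpi>\<^sup>2\<close>, as a function of the cosine, never exceeds
  \<open>1 / (\<theta>\<^sup>2 - 1) = \<Gamma>\<^sub>0 - 1\<close>, a value that it attains; this also identifies \<open>\<zeta>\<close> with the baseline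
  constant.
\<close>

section \<open>Coordinates of a vector relative to two others\<close>

text \<open>
  Gram-Schmidt and Bessel's inequality, stated for the entries of the Gram matrix of three vectors
  \<open>u, s, v\<close>, so that they apply to the inner product of any positive definite matrix:
  \<open>G, C, B\<close> are the squared norms and \<open>p = \<langle>u, s\<rangle>\<close>, \<open>r = \<langle>u, v\<rangle>\<close>, \<open>\<Delta> = \<langle>s, v\<rangle>\<close>. The numbers \<open>x, y\<close> are the
  coordinates of \<open>u\<close> in the orthonormal basis obtained from \<open>s, v\<close>. In that basis the components are
  \<open>s = (sqrt C, 0)\<close> and \<open>v = (\<Delta>, sqrt (C B - \<Delta>\<^sup>2)) / sqrt C\<close>. When \<open>s\<close> and \<open>v\<close> are parallel, \<open>y = 0\<close>
  works.
\<close>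

lemma gram_coordinates:
  fixes G C B p r \<Delta> :: real
  assumes psd: "\<And>a b c. 0 \<le> a\<^sup>2 * G + b\<^sup>2 * C + c\<^sup>2 * B + 2 * (a * b * p + a * c * r + b * c * \<Delta>)"
    and C: "0 < C"
  obtains x y where "p = sqrt C * x"
    and "sqrt C * r = \<Delta> * x + sqrt (C * B - \<Delta>\<^sup>2) * y"
    and "x\<^sup>2 + y\<^sup>2 \<le> G" and "\<Delta>\<^sup>2 \<le> C * B"
proof -
  define S where "S = sqrt C"
  have S: "S > 0" "C = S\<^sup>2" using C by (auto simp: S_def)
  \<comment> \<open>\<open>w\<close> is the product of \<open>u\<close> with \<open>C v - \<Delta> s\<close>, the part of \<open>v\<close> orthogonal to \<open>s\<close>, scaled by \<open>C\<close>;
    \<open>slice t\<close> is the squared norm of \<open>t u + C v - \<Delta> s\<close>.\<close>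
  define w where "w = r * C - p * \<Delta>"
  have slice: "0 \<le> t\<^sup>2 * G + C * (C * B - \<Delta>\<^sup>2) + 2 * t * w" for t
    using psd[of t "- \<Delta>" C] by (simp add: w_def algebra_simps power2_eq_square)
  have nonneg: "0 \<le> C * B - \<Delta>\<^sup>2"
    using slice[of 0] C by (simp add: zero_le_mult_iff)
  define h where "h = sqrt (C * B - \<Delta>\<^sup>2)"
  have h: "h \<ge> 0" "h\<^sup>2 = C * B - \<Delta>\<^sup>2" using nonneg by (auto simp: h_def)
  have G: "0 \<le> G" using psd[of 1 0 0] by simp
  have w0: "w = 0" if "h = 0"
  proof -
    \<comment> \<open>\<open>q\<^sup>2 G - 2 q w \<ge> 0\<close> for all \<open>q\<close> forces \<open>w = 0\<close>; the denominator \<open>G + 1\<close> in place of the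
      minimizing \<open>G\<close> avoids a case split on \<open>G = 0\<close>.\<close>
    define q where "q = w / (G + 1)"
    have w: "w = q * (G + 1)" using G by (simp add: q_def)
    have "0 \<le> q\<^sup>2 * G - 2 * q * w"
      using slice[of "- q"] h that by simp
    also have "\<dots> = - (q\<^sup>2 * (G + 2))"
      unfolding w by (simp add: algebra_simps power2_eq_square)
    finally have "q\<^sup>2 \<le> 0" using G by (simp add: mult_le_0_iff)
    thus "w = 0" using w by simp
  qed
  \<comment> \<open>Division by zero sets \<open>y = 0\<close> in the parallel case \<open>h = 0\<close>.\<close>
  define x where "x = p / S"
  define y where "y = w / (S * h)"
  have px: "p = S * x" using S by (simp add: x_def)
  have wy: "w = S * h * y" using S w0 by (cases "h = 0") (auto simp: y_def)
  have "S * (S * r) = S * (\<Delta> * x + h * y)"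
    using wy px S(2) by (simp add: w_def algebra_simps power2_eq_square)
  hence Sr: "S * r = \<Delta> * x + h * y" using S(1) by simp
  have "x\<^sup>2 + y\<^sup>2 \<le> G"
  proof (cases "h = 0")
    case True
    have "0 \<le> G - x\<^sup>2"
      using psd[of 1 "- x / S" 0] S px by (simp add: power_divide power2_eq_square)
    thus ?thesis using True by (simp add: y_def)
  next
    case False
    have r: "r = (h * y + x * \<Delta>) / S"
      using Sr S(1) by (simp add: field_simps)
    have B: "B = (h\<^sup>2 + \<Delta>\<^sup>2) / S\<^sup>2" using h S by (simp add: field_simps)
    \<comment> \<open>\<open>\<beta>, \<gamma>\<close> make \<open>u + \<beta> s + \<gamma> v\<close> the residual of \<open>u\<close> after projection onto the span of \<open>s\<close> and \<open>v\<close>.\<close>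
    define \<beta> \<gamma> where "\<beta> = - x / S + y * \<Delta> / (S * h)" and "\<gamma> = - y * S / h"
    have "1\<^sup>2 * G + \<beta>\<^sup>2 * C + \<gamma>\<^sup>2 * B + 2 * (1 * \<beta> * p + 1 * \<gamma> * r + \<beta> * \<gamma> * \<Delta>) = G - x\<^sup>2 - y\<^sup>2"
      using False S(1) unfolding \<beta>_def \<gamma>_def px r B S(2)
      by (simp add: field_simps power2_eq_square)
    hence "0 \<le> G - x\<^sup>2 - y\<^sup>2" using psd[of 1 \<beta> \<gamma>] by linarith
    thus ?thesis by simp
  qed
  thus ?thesis
    using that[of x y] px Sr nonneg by (simp add: S_def h_def)
qed

section \<open>The quadratic form and the extremal constant\<close>

text \<open>
  With \<open>e = \<Gamma> - 1 - k\<^sup>2\<close>, the difference of the two sides is \<open>(\<Gamma> - 1) (G - x\<^sup>2 - y\<^sup>2)\<close> plus a quadratic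
  form \<open>Q\<close> in \<open>x, y\<close>. Multiplying \<open>Q\<close> by its \<open>y\<^sup>2\<close>-coefficient \<open>e\<close> and completing the square leaves the
  determinant, which factors as \<open>(e - \<mu>) (e + (\<Gamma> - 1) \<mu>)\<close>. If \<open>e = 0\<close>, then \<open>\<mu> = 0\<close> and \<open>Q\<close> vanishes.
\<close>

lemma damped_rotation_bound:
  fixes \<Gamma> k \<mu> G x y :: real
  assumes G: "x\<^sup>2 + y\<^sup>2 \<le> G" and "1 \<le> \<Gamma>" and "0 \<le> \<mu>" and \<mu>: "\<mu> \<le> \<Gamma> - 1 - k\<^sup>2"
  shows "G + k\<^sup>2 * (x\<^sup>2 + y\<^sup>2) + (2 * \<mu> + \<mu>\<^sup>2) * x\<^sup>2 - 2 * \<mu> * k * x * y \<le> \<Gamma> * (G + \<mu> * x\<^sup>2)"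
proof -
  define e where "e = \<Gamma> - 1 - k\<^sup>2"
  define Q where "Q = e * (x\<^sup>2 + y\<^sup>2) + (\<Gamma> - 2 - \<mu>) * \<mu> * x\<^sup>2 + 2 * \<mu> * k * x * y"
  have \<Gamma>: "\<Gamma> = 1 + e + k\<^sup>2" by (simp add: e_def)
  have "0 \<le> Q"
  proof (cases "e = 0")
    case True
    thus ?thesis using assms by (simp add: Q_def e_def)
  next
    case False
    hence e: "e > 0" using assms by (simp add: e_def)
    have "e * Q = (e * y + \<mu> * k * x)\<^sup>2 + (e - \<mu>) * (e + (\<Gamma> - 1) * \<mu>) * x\<^sup>2"
      unfolding Q_def \<Gamma> by (simp add: algebra_simps power2_eq_square)
    also have "\<dots> \<ge> 0"
      using assms e by (intro add_nonneg_nonneg mult_nonneg_nonneg) (auto simp: e_def)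
    finally show ?thesis using e by (simp add: zero_le_mult_iff)
  qed
  moreover have "0 \<le> (\<Gamma> - 1) * (G - (x\<^sup>2 + y\<^sup>2))"
    using assms by (intro mult_nonneg_nonneg) auto
  ultimately show ?thesis
    unfolding Q_def e_def by (simp add: algebra_simps power2_eq_square)
qed

text \<open>
  After clearing denominators the difference of the two sides is the square of \<open>1 + \<theta> c\<close>, so the
  maximum is attained at the cosine \<open>c = - 1 / \<theta>\<close>.
\<close>

lemma varpi_sq_le:
  assumes "\<theta> > 1" and "\<bar>c\<bar> \<le> 1"
  shows "varpi_sq \<theta> c \<le> 1 / (\<theta>\<^sup>2 - 1)"
proof -
  have \<theta>: "\<theta>\<^sup>2 > 1" using assms by (simp add: one_less_power)
  have "\<theta> + c > 0" using assms by auto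
  moreover have "(1 - c\<^sup>2) * (\<theta>\<^sup>2 - 1) \<le> (\<theta> + c)\<^sup>2"
    using zero_le_power2[of "1 + \<theta> * c"] by (simp add: algebra_simps power2_eq_square)
  ultimately show ?thesis using \<theta> by (simp add: varpi_sq_def divide_simps)
qed

lemma Gamma0_eq:
  assumes "\<theta> > 1"
  shows "Gamma0 \<theta> = 1 + 1 / (\<theta>\<^sup>2 - 1)" and "zeta \<theta> = inverse (Gamma0 \<theta>)"
proof -
  have "\<theta>\<^sup>2 > 1" using assms by (simp add: one_less_power)
  hence "\<theta>\<^sup>2 - 1 \<noteq> 0" by linarith
  moreover have "\<theta> \<noteq> 0" using assms by simp
  ultimately show "Gamma0 \<theta> = 1 + 1 / (\<theta>\<^sup>2 - 1)" and "zeta \<theta> = inverse (Gamma0 \<theta>)"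
    by (simp_all add: Gamma0_def zeta_def field_simps)
qed

lemma zeta_eq_baseline_const:
  assumes "\<theta> > 1"
  shows "zeta \<theta> = baseline_const \<theta>"
proof -
  have \<theta>: "\<theta>\<^sup>2 > 1" using assms by (simp add: one_less_power)
  have "(GREATEST w. w \<in> varpi_sq \<theta> ` {-1..1}) = 1 / (\<theta>\<^sup>2 - 1)"
  proof (rule Greatest_equality)
    have "(1 - (- 1 / \<theta>)\<^sup>2) / (\<theta> + (- 1 / \<theta>))\<^sup>2 = 1 / (\<theta>\<^sup>2 - 1)"
    proof -
      have "1 - (- 1 / \<theta>)\<^sup>2 = (\<theta>\<^sup>2 - 1) / \<theta>\<^sup>2" "\<theta> + (- 1 / \<theta>) = (\<theta>\<^sup>2 - 1) / \<theta>"
        using assms by (simp_all add: field_simps power2_eq_square)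
      thus ?thesis using assms \<theta> by (simp add: power_divide power2_eq_square)
    qed
    thus "1 / (\<theta>\<^sup>2 - 1) \<in> varpi_sq \<theta> ` {-1..1}"
      using assms by (intro image_eqI[of _ _ "- 1 / \<theta>"]) (auto simp: varpi_sq_def le_divide_eq)
  next
    fix w assume "w \<in> varpi_sq \<theta> ` {-1..1}"
    thus "w \<le> 1 / (\<theta>\<^sup>2 - 1)" using varpi_sq_le[OF assms] by (auto simp: abs_le_iff)
  qed
  thus ?thesis using Gamma0_eq[OF assms] by (simp add: baseline_const_def)
qed

section \<open>The enhanced direction for a positive definite matrix\<close>

lemma inner_symmetric_matrix:
  fixes P :: "real ^ 'k ^ 'k"
  assumes "transpose P = P"
  shows "x \<bullet> (P *v y) = y \<bullet> (P *v x)"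
  by (metis assms dot_lmul_matrix inner_commute vector_transpose_matrix)

lemma matrix_inv_positive_definite:
  fixes P :: "real ^ 'k ^ 'k"
  assumes "\<And>x. x \<noteq> 0 \<Longrightarrow> 0 < x \<bullet> (P *v x)"
  shows "P *v (matrix_inv P *v x) = x"
proof -
  have "\<And>x. P *v x = 0 \<Longrightarrow> x = 0" using assms by force
  hence "invertible P"
    by (metis invertible_left_inverse matrix_left_invertible_ker)
  thus ?thesis
    unfolding invertible_def matrix_inv_def
    by (metis (mono_tags, lifting) matrix_vector_mul_assoc matrix_vector_mul_lid someI_ex)
qed

text \<open>
  In the basis of \<open>gram_coordinates\<close> the correction \<open>(\<langle>u, v\<rangle> s - \<langle>u, s\<rangle> v) / D\<close> is \<open>k (y, - x)\<close> and the
  damping term is \<open>- \<mu> (x, 0)\<close>; \<open>k\<close> becomes \<open>\<varpi>\<close> once numerator and denominator are divided by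
  \<open>sqrt (C B)\<close>.
\<close>

lemma direction_in_coordinates:
  fixes P :: "real ^ 'k ^ 'k"
  assumes sym: "transpose P = P" and pd: "\<And>x. x \<noteq> 0 \<Longrightarrow> 0 < x \<bullet> (P *v x)"
    and \<theta>: "\<theta> > 1" and s: "s \<noteq> 0" and b: "b \<noteq> 0"
  obtains x y k where "x\<^sup>2 + y\<^sup>2 \<le> g \<bullet> (matrix_inv P *v g)"
    and "k\<^sup>2 = varpi_sq \<theta> (chi_val P s b)"
    and "\<And>\<mu>. - (g \<bullet> direction \<theta> P g s b \<mu>) = g \<bullet> (matrix_inv P *v g) + \<mu> * x\<^sup>2"
    and "\<And>\<mu>. direction \<theta> P g s b \<mu> \<bullet> (P *v direction \<theta> P g s b \<mu>)
           = g \<bullet> (matrix_inv P *v g) + k\<^sup>2 * (x\<^sup>2 + y\<^sup>2) + (2 * \<mu> + \<mu>\<^sup>2) * x\<^sup>2 - 2 * \<mu> * k * x * y"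
    and "\<bar>chi_val P s b\<bar> \<le> 1"
proof -
  define u where "u = matrix_inv P *v g"
  define v where "v = matrix_inv P *v b"
  have Pu: "P *v u = g" and Pv: "P *v v = b"
    unfolding u_def v_def by (simp_all add: matrix_inv_positive_definite pd)
  have "v \<noteq> 0" using Pv b by auto
  define G C B p r \<Delta> D where "G = u \<bullet> (P *v u)" and "C = s \<bullet> (P *v s)" and "B = v \<bullet> (P *v v)"
    and "p = u \<bullet> (P *v s)" and "r = u \<bullet> (P *v v)" and "\<Delta> = s \<bullet> (P *v v)"
    and "D = D_val \<theta> P s b"
  note form_defs = G_def C_def B_def p_def r_def \<Delta>_def
  have pos: "C > 0" "B > 0" using pd s \<open>v \<noteq> 0\<close> by (auto simp: form_defs)
  have form: "(a *\<^sub>R u + c *\<^sub>R s + e *\<^sub>R v) \<bullet> (P *v (a *\<^sub>R u + c *\<^sub>R s + e *\<^sub>R v))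
      = a\<^sup>2 * G + c\<^sup>2 * C + e\<^sup>2 * B + 2 * (a * c * p + a * e * r + c * e * \<Delta>)" for a c e
    unfolding form_defs
    by (simp add: matrix_vector_right_distrib matrix_vector_mult_scaleR inner_add_left inner_add_right
        inner_symmetric_matrix[OF sym, of s u] inner_symmetric_matrix[OF sym, of v u]
        inner_symmetric_matrix[OF sym, of v s] algebra_simps power2_eq_square)
  have "0 \<le> x \<bullet> (P *v x)" for x using pd[of x] by (cases "x = 0") auto
  hence psd: "0 \<le> a\<^sup>2 * G + c\<^sup>2 * C + e\<^sup>2 * B + 2 * (a * c * p + a * e * r + c * e * \<Delta>)" for a c e
    using form[of a c e] by metis
  obtain x y where x: "p = sqrt C * x" and y: "sqrt C * r = \<Delta> * x + sqrt (C * B - \<Delta>\<^sup>2) * y"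
    and xy: "x\<^sup>2 + y\<^sup>2 \<le> G" and cs: "\<Delta>\<^sup>2 \<le> C * B"
    using gram_coordinates[OF psd pos(1)] by blast
  define k where "k = sqrt (C * B - \<Delta>\<^sup>2) / D"
  define S where "S = sqrt C"
  have S: "S > 0" "C = S\<^sup>2" using pos by (auto simp: S_def)
  define R where "R = sqrt (C * B)"
  have R: "R > 0" "R\<^sup>2 = C * B" using pos by (auto simp: R_def)
  have CB: "C_val P s = C" "B_val P b = B" "s \<bullet> b = \<Delta>"
    by (simp_all add: C_val_def B_val_def form_defs Pv inner_commute flip: v_def)
  have \<Delta>R: "\<bar>\<Delta>\<bar> \<le> R" using cs R by (simp add: R_def real_le_rsqrt)
  have chi: "chi_val P s b = \<Delta> / R" by (simp add: chi_val_def CB R_def)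
  have D: "D = \<Delta> + \<theta> * R" by (simp add: D_def D_val_def CB R_def)
  have "R < \<theta> * R" using \<theta> R by simp
  hence D0: "D > 0" using \<Delta>R unfolding D by linarith
  have k: "k\<^sup>2 = (C * B - \<Delta>\<^sup>2) / D\<^sup>2" using cs by (simp add: k_def power_divide)
  have "varpi_sq \<theta> (chi_val P s b) = (R\<^sup>2 - \<Delta>\<^sup>2) / D\<^sup>2"
  proof -
    have "1 - (\<Delta> / R)\<^sup>2 = (R\<^sup>2 - \<Delta>\<^sup>2) / R\<^sup>2" "\<theta> + \<Delta> / R = D / R"
      using R(1) by (simp_all add: D diff_divide_distrib add_divide_distrib power_divide)
    thus ?thesis using R(1) by (simp add: varpi_sq_def chi power_divide)
  qed
  hence kv: "k\<^sup>2 = varpi_sq \<theta> (chi_val P s b)" using k R by simp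
  have gp: "g \<bullet> u = G" "g \<bullet> s = p" "g \<bullet> v = r"
    using inner_symmetric_matrix[OF sym]
    by (simp_all add: form_defs Pu inner_commute flip: Pu)
  have dir: "direction \<theta> P g s b \<mu> = (- 1) *\<^sub>R u + (r / D - \<mu> * (p / C)) *\<^sub>R s + (- (p / D)) *\<^sub>R v" for \<mu>
    by (simp add: direction_def gp CB flip: u_def v_def D_def)
  have desc: "- (g \<bullet> direction \<theta> P g s b \<mu>) = G + \<mu> * x\<^sup>2" for \<mu>
    using S(1) unfolding dir
    by (simp add: inner_add_right gp inner_diff_right algebra_simps x flip: S_def)
       (simp add: S(2) power2_eq_square)
  \<comment> \<open>Substituting for \<open>p, r, B, C\<close> leaves \<open>\<Delta>\<close> and \<open>D\<close> as free parameters, and both cancel.\<close>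
  have rr: "r = (k * D * y + x * \<Delta>) / S"
    using y S(1) D0 unfolding k_def S_def[symmetric] by (simp add: field_simps)
  have BB: "B = (k\<^sup>2 * D\<^sup>2 + \<Delta>\<^sup>2) / S\<^sup>2" using k D0 S by (simp add: field_simps)
  have energy: "direction \<theta> P g s b \<mu> \<bullet> (P *v direction \<theta> P g s b \<mu>)
      = G + k\<^sup>2 * (x\<^sup>2 + y\<^sup>2) + (2 * \<mu> + \<mu>\<^sup>2) * x\<^sup>2 - 2 * \<mu> * k * x * y" for \<mu>
    using S(1) D0 unfolding dir form unfolding rr BB x S_def[symmetric] S(2)
    by (simp add: field_simps power2_eq_square)
  have "\<bar>chi_val P s b\<bar> \<le> 1" using \<Delta>R R by (simp add: chi)
  thus ?thesis using that[of x y k] xy kv desc energy gp(1) by (simp add: u_def)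
qed

section \<open>The preconditioner\<close>

lemma diag_mult_component: "(diag a *v x) $ i = a $ i * x $ i"
  by (simp add: diag_def matrix_vector_mult_def if_distrib[of "\<lambda>t. t * _"] cong: if_cong)

lemma transpose_diag: "transpose (diag a) = diag a"
  by (auto simp: diag_def transpose_def vec_eq_iff)

lemma inner_diag_nonneg:
  assumes "\<And>i. 0 \<le> a $ i"
  shows "0 \<le> x \<bullet> (diag a *v x)"
  unfolding inner_vec_def diag_mult_component
  using assms by (intro sum_nonneg) (simp add: mult.left_commute)

lemma transpose_P_mat: "transpose (P_mat f L \<delta> \<tau> z) = P_mat f L \<delta> \<tau> z"
proof -
  have add: "transpose (A + B) = transpose A + transpose B" for A B :: "real ^ 'k ^ 'k"
    by (simp add: transpose_def vec_eq_iff)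
  show ?thesis
    unfolding P_mat_def
    by (simp add: add transpose_scalar transpose_mat Pi_x_def D_mat_def transpose_diag
        matrix_transpose_mul matrix_mul_assoc)
qed

lemma P_mat_positive_definite:
  assumes "\<And>i. 0 \<le> L i" and "\<delta> > 0" and "x \<noteq> 0"
  shows "0 < x \<bullet> (P_mat f L \<delta> \<tau> z *v x)"
proof -
  let ?J = "J_mat f z"
  let ?D = "D_mat f \<tau> z"
  have "x \<bullet> (P_mat f L \<delta> \<tau> z *v x) = \<delta> * (x \<bullet> x) + (\<Sum>i\<in>UNIV. L i) * (x \<bullet> (Pi_x *v x))
      + (1/2) * ((?J *v x) \<bullet> (?D *v (?J *v x)))"
    unfolding P_mat_def matrix_vector_mult_add_rdistrib scaleR_matrix_vector_assoc[symmetric]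
      matrix_vector_mul_assoc[symmetric] inner_add_right inner_scaleR_right
    by (simp only: matrix_vector_mul_lid dot_lmul_matrix[symmetric] vector_transpose_matrix)
  moreover have "0 \<le> x \<bullet> (Pi_x *v x)"
    unfolding Pi_x_def by (rule inner_diag_nonneg) (auto split: sum.split)
  moreover have "0 \<le> (?J *v x) \<bullet> (?D *v (?J *v x))"
    unfolding D_mat_def by (rule inner_diag_nonneg) (simp add: omega_def)
  moreover have "0 \<le> (\<Sum>i\<in>UNIV. L i)" using assms by (simp add: sum_nonneg)
  moreover have "0 < \<delta> * (x \<bullet> x)" using assms by simp
  ultimately show ?thesis by (simp add: add_pos_nonneg)
qed

section \<open>The descent inequality\<close>

theorem theorem5p4:
  fixes f :: "'m::finite \<Rightarrow> real ^ 'n::finite \<Rightarrow> real"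
    and L :: "'m \<Rightarrow> real"
    and \<tau> \<delta> \<theta> :: real
    and z_prev z b :: "real ^ ('n + 1)"
  assumes "\<And>i. C1 (f i)"
    and "\<And>i. 0 \<le> L i"
    and "\<And>i. (L i)-lipschitz_on UNIV (gradient (f i))"
    and "\<tau> > 0" and "\<delta> > 0" and "\<theta> > 1"
    and "z_prev \<noteq> z" and "b \<noteq> 0"
  shows "let P = P_mat f L \<delta> \<tau> z;
             g = gradient (Phi f \<tau>) z;
             s = z - z_prev;
             d = direction \<theta> P g s b
         in (\<forall>\<mu>. 0 \<le> \<mu> \<and> \<mu> \<le> mu_star \<theta> P s b \<longrightarrow>
               - (g \<bullet> d \<mu>) \<ge> zeta \<theta> * (d \<mu> \<bullet> (P *v d \<mu>)))
          \<and> - (g \<bullet> d 0) = g \<bullet> (matrix_inv P *v g)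
          \<and> d 0 \<bullet> (P *v d 0) \<le> (1 + varpi_sq \<theta> (chi_val P s b)) * (g \<bullet> (matrix_inv P *v g))
          \<and> zeta \<theta> = baseline_const \<theta>"
proof -
  define P where "P = P_mat f L \<delta> \<tau> z"
  define g where "g = gradient (Phi f \<tau>) z"
  define s where "s = z - z_prev"
  define c where "c = chi_val P s b"
  define \<Gamma> where "\<Gamma> = Gamma0 \<theta>"
  have pd: "\<And>x. x \<noteq> 0 \<Longrightarrow> 0 < x \<bullet> (P *v x)"
    unfolding P_def by (rule P_mat_positive_definite) (use assms in auto)
  have sym: "transpose P = P" by (simp add: P_def transpose_P_mat)
  have "s \<noteq> 0" using assms by (simp add: s_def)
  obtain x y k where xy: "x\<^sup>2 + y\<^sup>2 \<le> g \<bullet> (matrix_inv P *v g)" and k: "k\<^sup>2 = varpi_sq \<theta> c"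
    and desc: "\<And>\<mu>. - (g \<bullet> direction \<theta> P g s b \<mu>) = g \<bullet> (matrix_inv P *v g) + \<mu> * x\<^sup>2"
    and energy: "\<And>\<mu>. direction \<theta> P g s b \<mu> \<bullet> (P *v direction \<theta> P g s b \<mu>)
           = g \<bullet> (matrix_inv P *v g) + k\<^sup>2 * (x\<^sup>2 + y\<^sup>2) + (2 * \<mu> + \<mu>\<^sup>2) * x\<^sup>2 - 2 * \<mu> * k * x * y"
    and c: "\<bar>c\<bar> \<le> 1"
    using direction_in_coordinates[OF sym pd \<open>\<theta> > 1\<close> \<open>s \<noteq> 0\<close> \<open>b \<noteq> 0\<close>, of g] unfolding c_def by blast
  have \<theta>: "\<theta>\<^sup>2 > 1" using \<open>\<theta> > 1\<close> by (simp add: one_less_power)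
  have \<Gamma>: "\<Gamma> = 1 + 1 / (\<theta>\<^sup>2 - 1)" "zeta \<theta> = inverse \<Gamma>" "1 \<le> \<Gamma>"
    using Gamma0_eq[OF \<open>\<theta> > 1\<close>] \<theta> by (auto simp: \<Gamma>_def)
  have gap: "0 \<le> \<Gamma> - 1 - k\<^sup>2"
    using varpi_sq_le[OF \<open>\<theta> > 1\<close> c] by (simp add: k \<Gamma>)
  have "zeta \<theta> * (direction \<theta> P g s b \<mu> \<bullet> (P *v direction \<theta> P g s b \<mu>))
      \<le> - (g \<bullet> direction \<theta> P g s b \<mu>)" if \<mu>: "0 \<le> \<mu>" "\<mu> \<le> mu_star \<theta> P s b" for \<mu>
  proof -
    have "mu_star \<theta> P s b = (\<Gamma> - 1 - k\<^sup>2) / (sqrt \<Gamma> + 1)"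
      by (simp add: mu_star_def k \<Gamma>_def c_def)
    also have "\<dots> \<le> (\<Gamma> - 1 - k\<^sup>2) / 1"
      using gap \<Gamma>(3) by (intro divide_left_mono) (auto intro: add_nonneg_pos)
    finally have "\<mu> \<le> \<Gamma> - 1 - k\<^sup>2" using \<mu> by simp
    from damped_rotation_bound[OF xy \<Gamma>(3) \<mu>(1) this] show ?thesis
      unfolding energy desc \<Gamma>(2) using \<Gamma>(3) by (simp add: field_simps)
  qed
  moreover have "- (g \<bullet> direction \<theta> P g s b 0) = g \<bullet> (matrix_inv P *v g)"
    using desc[of 0] by simp
  moreover have "direction \<theta> P g s b 0 \<bullet> (P *v direction \<theta> P g s b 0)
      \<le> (1 + varpi_sq \<theta> c) * (g \<bullet> (matrix_inv P *v g))"
    using mult_left_mono[OF xy zero_le_power2[of k]] unfolding energy by (simp add: k algebra_simps)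
  ultimately show ?thesis
    using zeta_eq_baseline_const[OF \<open>\<theta> > 1\<close>]
    unfolding Let_def P_def g_def s_def c_def by blast
qed

end
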